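(* Let $p\in(1,\infty)$ and $1/p+1/q=1$. Suppose that $X$ and $Y$ are two Hausdorff topological spaces and $E$ and $F$ are respectively vector sublattices of $C_{b}(X)$ and $C_{b}(Y)$ which contain the unit (the function identically $1$). Then every sublinear and monotone operator $T:E\to F$ for which $T(1)=1$ verifies the inequality \[ T(|fg|)\le [T(|f|^{p})]^{1/p}\cdot[T(|g|^{q})]^{1/q} \] for all $f,g\in E$ such that $fg\in E$.
   Context: For a Hausdorff topological space $X$, $C_{b}(X)$ denotes the vector lattice of all bounded continuous real-valued functions on $X$, with the pointwise ordering; a vector sublattice is a linear subspace closed under pointwise maximum and minimum of two functions. An operator $T:E\to F$ (not assumed linear) is sublinear if $T(f+g)\le T(f)+T(g)$ and $T(af)=aT(f)$ for all $f,g\in E$ and all real $a\ge 0$; it is monotone if $f\le g$ in $E$ implies $T(f)\le T(g)$. Inequalities, products and powers of functions are understood pointwise.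
   Formalization: The formal statement additionally assumes that |f|^p and |g|^q belong to E, since T is defined only on E and T(|f|^p), T(|g|^q) are otherwise undefined (e.g. E the piecewise linear functions on [0,1]). *)

theory Defs
  imports "HOL-Analysis.Analysis"
begin

text \<open>
  The set \<^const>\<open>bcontfun\<close> consists of the bounded continuous functions on the whole type, so
  at range type \<^typ>\<open>real\<close> it is \<open>C_b\<close> of the underlying space.  Operators are functions on all of
  \<^typ>\<open>'a \<Rightarrow> real\<close>, of which only the values on the sublattice \<open>E\<close> are relevant.
\<close>

definition vector_sublattice :: "('a::topological_space \<Rightarrow> real) set \<Rightarrow> bool" where
  "vector_sublattice E \<longleftrightarrow>
     E \<subseteq> bcontfun \<and>
     (\<lambda>x. 0) \<in> E \<and>
     (\<forall>f\<in>E. \<forall>g\<in>E. (\<lambda>x. f x + g x) \<in> E) \<and>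
     (\<forall>c. \<forall>f\<in>E. (\<lambda>x. c * f x) \<in> E) \<and>
     (\<forall>f\<in>E. \<forall>g\<in>E. (\<lambda>x. max (f x) (g x)) \<in> E) \<and>
     (\<forall>f\<in>E. \<forall>g\<in>E. (\<lambda>x. min (f x) (g x)) \<in> E)"

definition sublinear_on :: "('a \<Rightarrow> real) set \<Rightarrow> (('a \<Rightarrow> real) \<Rightarrow> ('b \<Rightarrow> real)) \<Rightarrow> bool" where
  "sublinear_on E T \<longleftrightarrow>
     (\<forall>f\<in>E. \<forall>g\<in>E. T (\<lambda>x. f x + g x) \<le> (\<lambda>y. T f y + T g y)) \<and>
     (\<forall>a\<ge>0. \<forall>f\<in>E. T (\<lambda>x. a * f x) = (\<lambda>y. a * T f y))"

end

theory Submission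
  imports Defs
begin

text \<open>
  Apply \<open>T\<close> to Young's inequality \<open>|f g| \<le> u v (|f|\<^sup>p / (p u\<^sup>p) + |g|\<^sup>q / (q v\<^sup>q))\<close> and evaluate at a
  point \<open>y\<close>.  With \<open>u\<^sup>p = T(|f|\<^sup>p)(y) + e\<close> and \<open>v\<^sup>q = T(|g|\<^sup>q)(y) + e\<close> the right-hand side is at
  most \<open>u v\<close>; letting \<open>e\<close> tend to \<open>0\<close> covers the case where one of the values vanishes.
\<close>

lemma vector_sublattice_abs:
  assumes "vector_sublattice E" "f \<in> E"
  shows "(\<lambda>x. \<bar>f x\<bar>) \<in> E"
proof -
  have "(\<lambda>x. -1 * f x) \<in> E"
    using assms unfolding vector_sublattice_def by metis
  with assms have "(\<lambda>x. max (f x) (-1 * f x)) \<in> E"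
    unfolding vector_sublattice_def by metis
  also have "(\<lambda>x. max (f x) (-1 * f x)) = (\<lambda>x. \<bar>f x\<bar>)"
    by (auto simp: max_def)
  finally show ?thesis .
qed

lemma conjugate_exponent_gt_1:
  fixes p q :: real
  assumes "1 < p" "1 / p + 1 / q = 1"
  shows "1 < q"
proof -
  have "1 / p < 1" "0 < 1 / p"
    using assms(1) by simp_all
  then have "0 < 1 / q" "1 / q < 1"
    using assms(2) by linarith+
  then show ?thesis
    by simp
qed

text \<open>With \<open>u = A powr (1/p)\<close> and \<open>v = B powr (1/q)\<close>, this is
  Young's inequality for \<open>a/u\<close> and \<open>b/v\<close>, multiplied by
  \<open>u * v\<close>. The bound is linear in \<open>a powr p\<close> and \<open>b powr q\<close>,
  so for fixed \<open>A\<close> and \<open>B\<close> a sublinear operator can be applied to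
  it.\<close>

lemma Young_scaled:
  fixes p q a b A B :: real
  assumes p: "1 < p" and pq: "1 / p + 1 / q = 1" and a: "0 \<le> a" and b: "0 \<le> b" and A: "0 < A" and B: "0 < B"
  shows "a * b \<le> A powr (1/p) * B powr (1/q) * (a powr p / (p * A) + b powr q / (q * B))"
proof -
  have q: "1 < q"
    by (rule conjugate_exponent_gt_1[OF p pq])
  define u v where "u = A powr (1/p)" and "v = B powr (1/q)"
  have u: "0 < u" "u powr p = A" and v: "0 < v" "v powr q = B"
    using A B p q by (auto simp: u_def v_def powr_powr)
  have "(a/u) * (b/v) \<le> (a/u) powr p / p + (b/v) powr q / q"
    using a b u v p q pq by (intro Youngs_inequality) auto
  also have "\<dots> = a powr p / (p * A) + b powr q / (q * B)"
    using a b u v by (simp add: powr_divide mult.commute)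
  finally have "u * v * ((a/u) * (b/v)) \<le> u * v * (a powr p / (p * A) + b powr q / (q * B))"
    using u v by (intro mult_left_mono) auto
  then show ?thesis
    using u v by (simp add: u_def v_def)
qed

text \<open>A vector sublattice need not be closed under products or powers, and the hypotheses on
  \<open>T\<close> concern only its values on \<open>E\<close>. Hence membership in \<open>E\<close>
  is required of both powers as well as of the product.\<close>

theorem theorem3:
  fixes p q :: real
    and E :: "('a::t2_space \<Rightarrow> real) set"
    and F :: "('b::t2_space \<Rightarrow> real) set"
    and T :: "('a \<Rightarrow> real) \<Rightarrow> ('b \<Rightarrow> real)"
    and f g :: "'a \<Rightarrow> real"
  assumes "1 < p" and "1 / p + 1 / q = 1"
    and "vector_sublattice E" and "(\<lambda>x. 1) \<in> E"
    and "vector_sublattice F" and "(\<lambda>y. 1) \<in> F"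
    and "T \<in> E \<rightarrow> F"
    and "sublinear_on E T"
    and "mono_on E T"
    and "T (\<lambda>x. 1) = (\<lambda>y. 1)"
    and "f \<in> E" and "g \<in> E"
    and "(\<lambda>x. f x * g x) \<in> E"
    and "(\<lambda>x. \<bar>f x\<bar> powr p) \<in> E" and "(\<lambda>x. \<bar>g x\<bar> powr q) \<in> E"
  shows "T (\<lambda>x. \<bar>f x * g x\<bar>)
           \<le> (\<lambda>y. T (\<lambda>x. \<bar>f x\<bar> powr p) y powr (1 / p) * T (\<lambda>x. \<bar>g x\<bar> powr q) y powr (1 / q))"
proof (rule le_funI)
  fix y
  let ?f = "\<lambda>x. \<bar>f x\<bar> powr p" and ?g = "\<lambda>x. \<bar>g x\<bar> powr q" and ?h = "\<lambda>x. \<bar>f x * g x\<bar>"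
  note E = \<open>vector_sublattice E\<close>
  have scaleE: "(\<lambda>x. c * k x) \<in> E" if "k \<in> E" for c k
    using E that unfolding vector_sublattice_def by metis
  have addE: "(\<lambda>x. k x + l x) \<in> E" if "k \<in> E" "l \<in> E" for k l
    using E that unfolding vector_sublattice_def by metis
  have zeroE: "(\<lambda>x. 0) \<in> E"
    using E unfolding vector_sublattice_def by blast
  have T_mono: "T k y \<le> T l y" if "k \<in> E" "l \<in> E" "k \<le> l" for k l
    by (rule le_funD[OF mono_onD[OF \<open>mono_on E T\<close> that]])
  have T_scale: "T (\<lambda>x. c * k x) y = c * T k y" if "k \<in> E" "0 \<le> c" for c k
  proof -
    have "T (\<lambda>x. c * k x) = (\<lambda>y. c * T k y)"
      using \<open>sublinear_on E T\<close> that unfolding sublinear_on_def by simp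
    then show ?thesis
      by (rule fun_cong)
  qed
  have T_add: "T (\<lambda>x. k x + l x) y \<le> T k y + T l y" if "k \<in> E" "l \<in> E" for k l
  proof -
    have "T (\<lambda>x. k x + l x) \<le> (\<lambda>y. T k y + T l y)"
      using \<open>sublinear_on E T\<close> that unfolding sublinear_on_def by simp
    then show ?thesis
      by (rule le_funD)
  qed
  \<comment> \<open>Homogeneity with factor 0 fixes the value at the zero function; monotonicity
    then makes \<open>T\<close> positive.\<close>
  have "T (\<lambda>x. 0) y = 0"
    using T_scale[OF zeroE, of 0] by simp
  then have T_nonneg: "0 \<le> T k y" if "k \<in> E" "\<And>x. 0 \<le> k x" for k
    using T_mono[OF zeroE that(1)] that(2) by (simp add: le_fun_def)
  have q: "1 < q"
    by (rule conjugate_exponent_gt_1[OF assms(1,2)])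
  have hE: "?h \<in> E"
    by (rule vector_sublattice_abs[OF E assms(13)])
  define A B where "A = T ?f y" and "B = T ?g y"
  have A: "0 \<le> A" and B: "0 \<le> B"
    unfolding A_def B_def using assms(14,15) by (auto intro: T_nonneg)
  have bound: "T ?h y \<le> (A + e) powr (1/p) * (B + e) powr (1/q)" if e: "0 < e" for e
  proof -
    define w where "w = (A + e) powr (1/p) * (B + e) powr (1/q)"
    \<comment> \<open>These are the coefficients of |f|^p and |g|^q in the scaled Young inequality
      with weights \<open>A + e\<close> and \<open>B + e\<close>. They depend on \<open>y\<close>
      but not on \<open>x\<close>, and being nonnegative they can be pulled out of
      \<open>T\<close>.\<close>
    define c d where "c = w / (p * (A + e))" and "d = w / (q * (B + e))"
    have w: "0 \<le> w" by (simp add: w_def)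
    have c: "0 \<le> c" and d: "0 \<le> d"
      using w A B e \<open>1 < p\<close> q by (auto simp: c_def d_def)
    have "?h x \<le> c * ?f x + d * ?g x" for x
      using Young_scaled[OF assms(1,2), of "\<bar>f x\<bar>" "\<bar>g x\<bar>" "A + e" "B + e"] A B e
      by (simp add: abs_mult c_def d_def w_def algebra_simps)
    then have "T ?h y \<le> T (\<lambda>x. c * ?f x + d * ?g x) y"
      using hE assms(14,15) by (intro T_mono addE scaleE) (auto simp: le_fun_def)
    also have "\<dots> \<le> T (\<lambda>x. c * ?f x) y + T (\<lambda>x. d * ?g x) y"
      using assms(14,15) by (intro T_add scaleE)
    also have "\<dots> = c * A + d * B"
      using assms(14,15) c d by (simp add: T_scale A_def B_def)
    also have "\<dots> = w * (1/p * (A / (A + e)) + 1/q * (B / (B + e)))"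
      by (simp add: c_def d_def algebra_simps)
    \<comment> \<open>Both quotients are at most 1 because \<open>e\<close> is positive; the
      conjugacy of \<open>p\<close> and \<open>q\<close> then leaves exactly
      \<open>w\<close>.\<close>
    also have "\<dots> \<le> w * (1/p * 1 + 1/q * 1)"
      using w A B e \<open>1 < p\<close> q by (intro mult_left_mono add_mono) auto
    finally show ?thesis
      using assms(2) by (simp add: w_def)
  qed
  have pos: "\<forall>\<^sub>F e in at_right 0. (0::real) < e"
    by (rule eventually_at_right_less)
  \<comment> \<open>The case \<open>C = 0\<close> matters here: continuity of the power at base 0
    uses the positive exponent and a base that stays nonnegative, hence the one-sided limit.\<close>
  have lim: "((\<lambda>e. (C + e) powr r) \<longlongrightarrow> C powr r) (at_right 0)" if "0 \<le> C" "0 < r" for C r :: real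
  proof (rule tendsto_powr2)
    show "((\<lambda>e. C + e) \<longlongrightarrow> C) (at_right 0)"
      by (rule tendsto_eq_intros refl | simp)+
    show "\<forall>\<^sub>F e in at_right 0. 0 \<le> C + e"
      using pos by eventually_elim (use that in simp)
  qed (use that in simp_all)
  have "((\<lambda>e. (A + e) powr (1/p) * (B + e) powr (1/q)) \<longlongrightarrow> A powr (1/p) * B powr (1/q)) (at_right 0)"
    using A B \<open>1 < p\<close> q by (intro tendsto_mult lim) simp_all
  moreover have "\<forall>\<^sub>F e in at_right 0. T ?h y \<le> (A + e) powr (1/p) * (B + e) powr (1/q)"
    using pos by eventually_elim (rule bound)
  ultimately have "T ?h y \<le> A powr (1/p) * B powr (1/q)"
    by (rule tendsto_lowerbound) simp
  then show "T ?h y \<le> T ?f y powr (1 / p) * T ?g y powr (1 / q)"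
    by (simp add: A_def B_def)
qed

end
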